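(* For every integer $t \ge 3$, the integer $4t+2$ is a magic constant.
   Context: All graphs $G=(V,E)$ are finite, simple (undirected, no loops or multiple edges), with nonempty vertex set, and not necessarily connected. A positive integer $k$ is called a magic constant if there exist a graph $G=(V,E)$ and a bijection $f: V \to \{1,2,\dots,|V|\}$ such that for every vertex $v \in V$ the weight $w(v) = \sum_{u \in N(v)} f(u)$ equals $k$, where $N(v) = \{u \in V : uv \in E\}$ is the (open) neighborhood of $v$. *)

theory Defs
  imports "Graph_Theory.Pair_Digraph"
begin

text \<open>
  The locale \<open>pair_graph\<close> describes the finite simple undirected graphs: finite vertex set, no
  loops, no parallel arcs, and a symmetric arc relation, so that an edge \<open>uv\<close> is the pair of arcs
  \<open>(u, v)\<close> and \<open>(v, u)\<close>. It admits the graph without vertices, which is excluded separately.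
\<close>

definition open_nbhd :: "'a pair_pre_digraph \<Rightarrow> 'a \<Rightarrow> 'a set" where
  "open_nbhd G v = {u \<in> pverts G. (u, v) \<in> parcs G}"

definition weight :: "'a pair_pre_digraph \<Rightarrow> ('a \<Rightarrow> nat) \<Rightarrow> 'a \<Rightarrow> nat" where
  "weight G f v = (\<Sum>u\<in>open_nbhd G v. f u)"

definition distance_magic_labeling :: "'a pair_pre_digraph \<Rightarrow> ('a \<Rightarrow> nat) \<Rightarrow> nat \<Rightarrow> bool" where
  "distance_magic_labeling G f k \<longleftrightarrow>
     bij_betw f (pverts G) {1..card (pverts G)} \<and> (\<forall>v\<in>pverts G. weight G f v = k)"

text \<open>
  HOL cannot quantify over vertex types inside a formula, so the graph is taken to have natural
  numbers as vertices. Every finite graph is isomorphic to such a graph; the lemma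
  \<open>magic_constantI\<close> below shows that no magic constant is lost.
\<close>

definition magic_constant :: "nat \<Rightarrow> bool" where
  "magic_constant k \<longleftrightarrow> k > 0 \<and>
     (\<exists>(G :: nat pair_pre_digraph) f. pair_graph G \<and> pverts G \<noteq> {} \<and> distance_magic_labeling G f k)"

lemma magic_constantI:
  fixes G :: "'a pair_pre_digraph"
  assumes k: "k > 0" and G: "pair_graph G" and ne: "pverts G \<noteq> {}"
    and f: "distance_magic_labeling G f k"
  shows "magic_constant k"
proof -
  interpret G: pair_graph G by fact
  let ?V = "pverts G"
  have bij: "bij_betw f ?V {1..card ?V}"
    and w: "\<And>v. v \<in> ?V \<Longrightarrow> weight G f v = k"
    using f by (auto simp: distance_magic_labeling_def)
  have inj: "inj_on f ?V" and img: "f ` ?V = {1..card ?V}"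
    using bij by (auto simp: bij_betw_def)
  define H where "H = \<lparr>pverts = f ` ?V, parcs = map_prod f f ` parcs G\<rparr>"
  have mem: "u \<in> ?V \<and> v \<in> ?V" if "(u, v) \<in> parcs G" for u v
    using that G.in_arcsD1 G.in_arcsD2 by blast
  have arc: "(f u, f v) \<in> parcs H \<longleftrightarrow> (u, v) \<in> parcs G" if "u \<in> ?V" "v \<in> ?V" for u v
    using that inj mem by (force simp: H_def inj_on_eq_iff)
  have "pair_graph H"
  proof unfold_locales
    show "symmetric (with_proj H)"
      using G.arcs_symmetric by (force simp: symmetric_def H_def sym_def)
  next
    fix e assume "e \<in> parcs H"
    then obtain u v where "e = (f u, f v)" "(u, v) \<in> parcs G" by (auto simp: H_def)
    then show "fst e \<noteq> snd e"
      using inj mem G.no_loops' by (auto simp: inj_on_eq_iff)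
  qed (use mem G.pair_finite_verts G.pair_finite_arcs in \<open>auto simp: H_def\<close>)
  moreover have "pverts H \<noteq> {}" using ne by (simp add: H_def)
  moreover have "distance_magic_labeling H id k"
    unfolding distance_magic_labeling_def
  proof (intro conjI ballI)
    show "bij_betw id (pverts H) {1..card (pverts H)}"
      by (simp add: H_def img)
  next
    fix x assume "x \<in> pverts H"
    then obtain v where v: "v \<in> ?V" "x = f v" by (auto simp: H_def)
    have "open_nbhd H x = f ` open_nbhd G v"
    proof -
      have "open_nbhd H x = {y \<in> f ` ?V. (y, f v) \<in> parcs H}"
        using v by (simp add: open_nbhd_def H_def)
      also have "\<dots> = f ` open_nbhd G v"
        using v(1) arc by (auto simp: open_nbhd_def)
      finally show ?thesis .
    qed
    moreover have "inj_on f (open_nbhd G v)"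
      using inj by (rule inj_on_subset) (auto simp: open_nbhd_def)
    ultimately have "weight H id x = weight G f v"
      by (simp add: weight_def sum.reindex)
    then show "weight H id x = k" using w v by simp
  qed
  ultimately show ?thesis using k by (auto simp: magic_constant_def)
qed

end

theory Submission
  imports Defs
begin

text \<open>
  Split \<open>{1..2 * n}\<close> into \<open>n\<close> pairs of sum \<open>2 * n + 1\<close> and blow up the cycle \<open>C\<^sub>n\<close> by replacing each
  vertex with such a pair, an independent set. Every vertex then sees exactly two full pairs, so
  its weight is \<open>2 * (2 * n + 1)\<close>.
\<close>

text \<open>The bounds are part of the relation, so that arcs built from it cannot leave the vertex
  set \<open>{..<n} \<times> UNIV\<close>.\<close>

definition cycle_adj :: "nat \<Rightarrow> nat \<Rightarrow> nat \<Rightarrow> bool" where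
  "cycle_adj n i j \<longleftrightarrow> i < n \<and> j < n \<and> (j = Suc i mod n \<or> i = Suc j mod n)"

definition doubled_cycle :: "nat \<Rightarrow> (nat \<times> bool) pair_pre_digraph" where
  "doubled_cycle n = \<lparr>pverts = {..<n} \<times> UNIV, parcs = {(u, v). cycle_adj n (fst u) (fst v)}\<rparr>"

text \<open>For \<open>i < n\<close> the \<open>False\<close> copies take the labels from
  \<open>1\<close> up to \<open>n\<close>, the \<open>True\<close> copies those from
  \<open>2 * n\<close> down to \<open>n + 1\<close>.\<close>

definition pair_labeling :: "nat \<Rightarrow> nat \<times> bool \<Rightarrow> nat" where
  "pair_labeling n = (\<lambda>(i, b). if b then 2 * n - i else Suc i)"

lemma cycle_adj_sym: "cycle_adj n i j \<longleftrightarrow> cycle_adj n j i"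
  by (auto simp: cycle_adj_def)

lemma cycle_adj_irrefl: "n \<ge> 2 \<Longrightarrow> \<not> cycle_adj n i i"
  by (auto simp: cycle_adj_def mod_Suc split: if_splits)

text \<open>Successor and predecessor modulo \<open>n\<close> are distinct once
  \<open>n \<ge> 3\<close>; for \<open>n = 2\<close> they coincide.\<close>

lemma card_cycle_adj:
  assumes "n \<ge> 3" "i < n"
  shows "card {j. cycle_adj n j i} = 2"
proof -
  \<comment> \<open>The predecessor of \<open>i\<close> modulo \<open>n\<close>; the case split
    keeps truncated subtraction from giving \<open>0\<close> at \<open>i = 0\<close>.\<close>
  define p where "p = (if i = 0 then n - 1 else i - 1)"
  have "{j. cycle_adj n j i} = {Suc i mod n, p}"
    using assms by (auto simp: cycle_adj_def p_def mod_Suc split: if_splits)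
  moreover have "Suc i mod n \<noteq> p"
    using assms by (auto simp: p_def mod_Suc)
  ultimately show ?thesis by simp
qed

lemma pair_graph_doubled_cycle:
  assumes "n \<ge> 2"
  shows "pair_graph (doubled_cycle n)"
proof unfold_locales
  have "parcs (doubled_cycle n) \<subseteq> pverts (doubled_cycle n) \<times> pverts (doubled_cycle n)"
    by (auto simp: doubled_cycle_def cycle_adj_def)
  moreover show "finite (pverts (doubled_cycle n))"
    by (simp add: doubled_cycle_def)
  ultimately show "finite (parcs (doubled_cycle n))"
    by (meson finite_SigmaI finite_subset)
  show "symmetric (with_proj (doubled_cycle n))"
    using cycle_adj_sym by (auto simp: symmetric_def sym_def doubled_cycle_def)
qed (use cycle_adj_irrefl[OF assms] in \<open>auto simp: doubled_cycle_def cycle_adj_def\<close>)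

lemma bij_betw_pair_labeling:
  "bij_betw (pair_labeling n) ({..<n} \<times> UNIV) {1..2 * n}"
  \<comment> \<open>The inverse reads the copy off the size of the label: at most \<open>n\<close>
    means \<open>False\<close>.\<close>
  by (rule bij_betw_byWitness[where f' = "\<lambda>x. if x \<le> n then (x - 1, False) else (2 * n - x, True)"])
     (auto simp: pair_labeling_def split: if_splits)

lemma weight_doubled_cycle:
  assumes "n \<ge> 3" "v \<in> pverts (doubled_cycle n)"
  shows "weight (doubled_cycle n) (pair_labeling n) v = 2 * (2 * n + 1)"
proof -
  let ?N = "{j. cycle_adj n j (fst v)}"
  \<comment> \<open>Adjacency ignores the Boolean component, so a neighborhood contains both copies
    or neither.\<close>
  have nbhd: "open_nbhd (doubled_cycle n) v = ?N \<times> UNIV"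
    by (auto simp: open_nbhd_def doubled_cycle_def cycle_adj_def)
  have "weight (doubled_cycle n) (pair_labeling n) v = (\<Sum>j\<in>?N. \<Sum>b\<in>UNIV. pair_labeling n (j, b))"
    by (simp add: weight_def nbhd sum.cartesian_product)
  also have "\<dots> = (\<Sum>j\<in>?N. 2 * n + 1)"
    \<comment> \<open>Membership in \<open>?N\<close> gives \<open>j < n\<close>, so
      \<open>Suc j + (2 * n - j)\<close> is indeed \<open>2 * n + 1\<close> despite truncated
      subtraction.\<close>
    by (rule sum.cong) (auto simp: UNIV_bool pair_labeling_def cycle_adj_def)
  also have "\<dots> = 2 * (2 * n + 1)"
    using assms card_cycle_adj by (auto simp: doubled_cycle_def)
  finally show ?thesis .
qed

theorem theorem2p6:
  fixes t :: nat
  assumes "t \<ge> 3"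
  shows "magic_constant (4 * t + 2)"
proof (rule magic_constantI)
  show "pair_graph (doubled_cycle t)"
    using assms by (intro pair_graph_doubled_cycle) simp
  show "pverts (doubled_cycle t) \<noteq> {}"
    using assms by (auto simp: doubled_cycle_def lessThan_empty_iff)
  have "card (pverts (doubled_cycle t)) = 2 * t"
    by (simp add: doubled_cycle_def card_cartesian_product)
  then show "distance_magic_labeling (doubled_cycle t) (pair_labeling t) (4 * t + 2)"
    using bij_betw_pair_labeling[of t] weight_doubled_cycle[OF assms]
    by (simp add: distance_magic_labeling_def doubled_cycle_def mult.commute)
qed simp

end
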